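(* Let $A\in\mathbb{R}^{n\times n}$, $B\in\mathbb{R}^{n\times m}$ and $C=I_n$ (full-state coupling). Assume all eigenvalues of $A$ lie in the closed unit disc, $(A,B)$ is stabilizable and $(A,C)$ is detectable. Then the scalable delayed regulated state synchronization problem (defined in the context) is solvable. In particular, let $K\in\mathbb{R}^{m\times n}$ be such that $A-BK$ is Schur stable (such a $K$ depends only on the agent model), and let each agent $i$ use the protocol $$\chi_i(k+1)=A\chi_i(k)+Bu_i(k)+A\bar\zeta_i(k)-A\hat\zeta_i(k),\qquad u_i(k)=-K\chi_i(k),$$ with $\chi_i(k)\in\mathbb{R}^n$ and with exchanged variable $\xi_i=\chi_i$, i.e. $\hat\zeta_i(k)=\chi_i(k)-\sum_{j=1}^N\bar d_{ij}\chi_j(k-\hat\kappa_{ij})$. Then for every $N$, every graph $\mathcal{G}\in\mathbb{G}^N$, all communication delays $\kappa_{ij}$, $\hat\kappa_{ij}$ and all initial conditions, delayed regulated state synchronization is achieved: $$\lim_{k\to\infty}\big[x_i(k)-x_r(k-\kappa_{ir})\big]=0\quad\text{for all } i\in\{1,\dots,N\}.$$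
   Context: Schur stable: all eigenvalues of the square matrix lie in the open unit disc. Agents: for $i=1,\dots,N$, $x_i(k+1)=Ax_i(k)+Bu_i(k)$, $y_i(k)=Cx_i(k)$, with $x_i\in\mathbb{R}^n$, $u_i\in\mathbb{R}^m$, $y_i\in\mathbb{R}^p$. Exosystem: $x_r(k+1)=Ax_r(k)$, $y_r(k)=Cx_r(k)$, $x_r(0)=x_{r0}$ arbitrary. Graphs: a weighted graph on nodes $\{1,\dots,N\}$ has weights $a_{ij}\ge 0$, $a_{ii}=0$, where $a_{ij}>0$ iff there is an edge from $j$ to $i$. Its Laplacian $L=[\ell_{ij}]$ has $\ell_{ii}=\sum_k a_{ik}$ and $\ell_{ij}=-a_{ij}$ for $i\ne j$. $\mathbb{G}^N$ is the set of weighted graphs on $N$ nodes that are themselves directed spanning trees (one root with no parent, every other node has exactly one parent, and the root has a directed path to every other node), with nodes numbered so that $L$ is lower triangular; thus node $1$ is the root, the first row of $L$ is zero, and $\ell_{ii}>0$ for $i\ge 2$. Expanded Laplacian: $\iota_1=1$, $\iota_i=0$ for $i\ge2$ (only the root agent receives exosystem information); $\bar L=[\bar\ell_{ij}]=L+\mathrm{diag}\{\iota_i\}$; $d_{in}(i)=\sum_j a_{ij}$, $D_{in}=\mathrm{diag}\{d_{in}(i)\}$; $\bar D=[\bar d_{ij}]=I-(2I+D_{in})^{-1}\bar L$. Delays: for $j\neq i$, $\kappa_{ij}\in\mathbb{N}^+$ and $\hat\kappa_{ij}\in\mathbb{N}^+$ are unknown constant communication delays from agent $j$ to agent $i$ (relevant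 only when $a_{ij}>0$), for the output exchange and for the protocol-variable exchange respectively; $\kappa_{ii}=\hat\kappa_{ii}=0$. $\kappa_{1r}$ is the unknown constant nonnegative integer delay from the exosystem to agent $1$. For $i\ge2$, $\kappa_{ir}$ is the sum of the delays ($\kappa_{1r}$ and the $\kappa$'s of the edges) along the unique path from the exosystem via agent 1 to agent $i$, so $\kappa_{ij}=\kappa_{ir}-\kappa_{jr}$ for each edge from $j$ to $i$. Information available to agent $i$: $$\bar\zeta_i(k)=\frac{1}{2+d_{in}(i)}\sum_{j=1}^N\bar\ell_{ij}\big(y_j(k-\kappa_{ij})-y_r(k-\kappa_{ir})\big)=y_i(k)-y_r(k-\kappa_{ir})-\sum_{j=1}^N\bar d_{ij}\big(y_j(k-\kappa_{ij})-y_r(k-\kappa_{ir})\big),$$ $$\hat\zeta_i(k)=\frac{1}{2+d_{in}(i)}\sum_{j=1}^N\bar\ell_{ij}\xi_j(k-\hat\kappa_{ij})=\xi_i(k)-\sum_{j=1}^N\bar d_{ij}\xi_j(k-\hat\kappa_{ij}),$$ where $\xi_j\in\mathbb{R}^n$ is a variable produced by the protocol of agent $j$. Initial conditions include arbitrary initial data at the finitely many negative times needed by the delays. Scalable delayed regulated state synchronization problem: find, using only knowledge of the agent model $(A,B,C)$ (in particular not of $N$, the graph, or the delays), matrices $A_c,B_{c1},B_{c2},F_c,H_c$ such that the protocol $$x_{c,i}(k+1)=A_cx_{c,i}(k)+B_{c1}\bar\zeta_i(k)+B_{c2}\hat\zeta_i(k),\quad u_i(k)=F_cx_{c,i}(k),\quad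 \xi_i(k)=H_cx_{c,i}(k),$$ $x_{c,i}\in\mathbb{R}^{n_c}$, achieves, for any $N$, any graph $\mathcal{G}\in\mathbb{G}^N$, any delays $\kappa_{ij},\hat\kappa_{ij}$ and any initial conditions, $\lim_{k\to\infty}[x_i(k)-x_r(k-\kappa_{ir})]=0$ for all $i\in\{1,\dots,N\}$. *)

theory Defs
  imports Complex_Main "Jordan_Normal_Form.Char_Poly"
begin

section \<open>Stability, stabilizability, detectability\<close>

definition eigenvalues_in_closed_disc :: "real mat \<Rightarrow> bool" where
  "eigenvalues_in_closed_disc A \<longleftrightarrow>
     (\<forall>ev. eigenvalue (map_mat complex_of_real A) ev \<longrightarrow> cmod ev \<le> 1)"

definition schur_stable :: "real mat \<Rightarrow> bool" where
  "schur_stable A \<longleftrightarrow>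
     (\<forall>ev. eigenvalue (map_mat complex_of_real A) ev \<longrightarrow> cmod ev < 1)"

definition stabilizable :: "real mat \<Rightarrow> real mat \<Rightarrow> bool" where
  "stabilizable A B \<longleftrightarrow>
     (\<exists>K \<in> carrier_mat (dim_col B) (dim_row A). schur_stable (A - B * K))"

definition detectable :: "real mat \<Rightarrow> real mat \<Rightarrow> bool" where
  "detectable A C \<longleftrightarrow>
     (\<exists>G \<in> carrier_mat (dim_row A) (dim_row C). schur_stable (A - G * C))"


section \<open>Weighted graphs and Laplacians\<close>

text \<open>
  A weighted graph on the nodes \<open>{1..N}\<close> is given by its weights \<open>a i j\<close>; there is an edge
  from \<open>j\<close> to \<open>i\<close> iff \<open>a i j > 0\<close>. Values of \<open>a\<close> outside \<open>{1..N}\<close> are never used.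
\<close>

definition in_degree :: "nat \<Rightarrow> (nat \<Rightarrow> nat \<Rightarrow> real) \<Rightarrow> nat \<Rightarrow> real" where
  "in_degree N a i = (\<Sum>j = 1..N. a i j)"

definition laplacian :: "nat \<Rightarrow> (nat \<Rightarrow> nat \<Rightarrow> real) \<Rightarrow> nat \<Rightarrow> nat \<Rightarrow> real" where
  "laplacian N a i j = (if i = j then (\<Sum>k = 1..N. a i k) else - a i j)"

definition iota :: "nat \<Rightarrow> real" where
  "iota i = (if i = 1 then 1 else 0)"

definition exp_laplacian :: "nat \<Rightarrow> (nat \<Rightarrow> nat \<Rightarrow> real) \<Rightarrow> nat \<Rightarrow> nat \<Rightarrow> real" where
  "exp_laplacian N a i j = laplacian N a i j + (if i = j then iota i else 0)"

text \<open>The entries of \<open>I - (2I + D\<^sub>i\<^sub>n)\<inverse> L\<close>, where \<open>L\<close> is the expanded Laplacian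
  and \<open>D\<^sub>i\<^sub>n\<close> is the diagonal matrix of in-degrees.\<close>

definition dbar :: "nat \<Rightarrow> (nat \<Rightarrow> nat \<Rightarrow> real) \<Rightarrow> nat \<Rightarrow> nat \<Rightarrow> real" where
  "dbar N a i j =
     (if i = j then 1 else 0) - inverse (2 + in_degree N a i) * exp_laplacian N a i j"

definition edges :: "nat \<Rightarrow> (nat \<Rightarrow> nat \<Rightarrow> real) \<Rightarrow> (nat \<times> nat) set" where
  "edges N a = {(j, i). j \<in> {1..N} \<and> i \<in> {1..N} \<and> a i j > 0}"

definition weighted_graph :: "nat \<Rightarrow> (nat \<Rightarrow> nat \<Rightarrow> real) \<Rightarrow> bool" where
  "weighted_graph N a \<longleftrightarrow>
     (\<forall>i \<in> {1..N}. \<forall>j \<in> {1..N}. a i j \<ge> 0) \<and> (\<forall>i \<in> {1..N}. a i i = 0)"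

definition directed_spanning_tree :: "nat \<Rightarrow> (nat \<Rightarrow> nat \<Rightarrow> real) \<Rightarrow> bool" where
  "directed_spanning_tree N a \<longleftrightarrow>
     (\<exists>r \<in> {1..N}.
        (\<nexists>j. (j, r) \<in> edges N a) \<and>
        (\<forall>i \<in> {1..N} - {r}. \<exists>!j. (j, i) \<in> edges N a) \<and>
        (\<forall>i \<in> {1..N} - {r}. (r, i) \<in> (edges N a)\<^sup>+))"

definition lower_triangular :: "nat \<Rightarrow> (nat \<Rightarrow> nat \<Rightarrow> real) \<Rightarrow> bool" where
  "lower_triangular N L \<longleftrightarrow> (\<forall>i \<in> {1..N}. \<forall>j \<in> {1..N}. i < j \<longrightarrow> L i j = 0)"

definition tree_graph :: "nat \<Rightarrow> (nat \<Rightarrow> nat \<Rightarrow> real) \<Rightarrow> bool" where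
  "tree_graph N a \<longleftrightarrow>
     weighted_graph N a \<and> directed_spanning_tree N a \<and> lower_triangular N (laplacian N a)"


section \<open>Delays\<close>

definition comm_delays :: "nat \<Rightarrow> (nat \<Rightarrow> nat \<Rightarrow> nat) \<Rightarrow> bool" where
  "comm_delays N \<kappa> \<longleftrightarrow>
     (\<forall>i \<in> {1..N}. \<kappa> i i = 0) \<and> (\<forall>i \<in> {1..N}. \<forall>j \<in> {1..N}. j \<noteq> i \<longrightarrow> \<kappa> i j \<ge> 1)"

definition root_path :: "nat \<Rightarrow> (nat \<Rightarrow> nat \<Rightarrow> real) \<Rightarrow> nat \<Rightarrow> nat list \<Rightarrow> bool" where
  "root_path N a i p \<longleftrightarrow>
     p \<noteq> [] \<and> hd p = 1 \<and> last p = i \<and> set p \<subseteq> {1..N} \<and>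
     (\<forall>l. Suc l < length p \<longrightarrow> (p ! l, p ! Suc l) \<in> edges N a)"

text \<open>The delay \<open>\<kappa>\<^sub>i\<^sub>r\<close>: \<open>\<kappa>1r\<close> is the delay from the exosystem to agent 1, to which the delays
  along the path from agent 1 to agent \<open>i\<close> are added; the path is unique in a \<open>tree_graph\<close>.\<close>

definition exo_delay ::
  "nat \<Rightarrow> (nat \<Rightarrow> nat \<Rightarrow> real) \<Rightarrow> (nat \<Rightarrow> nat \<Rightarrow> nat) \<Rightarrow> nat \<Rightarrow> nat \<Rightarrow> nat" where
  "exo_delay N a \<kappa> \<kappa>1r i =
     (let p = (THE p. root_path N a i p)
      in \<kappa>1r + (\<Sum>l < length p - 1. \<kappa> (p ! Suc l) (p ! l)))"


section \<open>Agents, exosystem and exchanged information\<close>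

text \<open>
  Time is of type \<open>int\<close>. The dynamics constrain signals only from time \<open>0\<close> on; the values at
  negative times are arbitrary vectors of the right dimension and, together with the state at
  time \<open>0\<close>, form the initial conditions.
\<close>

type_synonym signal = "int \<Rightarrow> real vec"

definition agent_dynamics ::
  "nat \<Rightarrow> nat \<Rightarrow> nat \<Rightarrow> real mat \<Rightarrow> real mat \<Rightarrow> real mat \<Rightarrow> nat \<Rightarrow>
   (nat \<Rightarrow> signal) \<Rightarrow> (nat \<Rightarrow> signal) \<Rightarrow> (nat \<Rightarrow> signal) \<Rightarrow> bool" where
  "agent_dynamics n m p A B C N x u y \<longleftrightarrow>
     (\<forall>i \<in> {1..N}.
        (\<forall>k. x i k \<in> carrier_vec n \<and> u i k \<in> carrier_vec m \<and> y i k \<in> carrier_vec p) \<and>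
        (\<forall>k \<ge> 0. x i (k + 1) = A *\<^sub>v x i k + B *\<^sub>v u i k \<and> y i k = C *\<^sub>v x i k))"

definition exosystem_dynamics ::
  "nat \<Rightarrow> nat \<Rightarrow> real mat \<Rightarrow> real mat \<Rightarrow> signal \<Rightarrow> signal \<Rightarrow> bool" where
  "exosystem_dynamics n p A C xr yr \<longleftrightarrow>
     (\<forall>k. xr k \<in> carrier_vec n \<and> yr k \<in> carrier_vec p) \<and>
     (\<forall>k \<ge> 0. xr (k + 1) = A *\<^sub>v xr k \<and> yr k = C *\<^sub>v xr k)"

definition zeta_bar ::
  "nat \<Rightarrow> nat \<Rightarrow> (nat \<Rightarrow> nat \<Rightarrow> real) \<Rightarrow> (nat \<Rightarrow> nat \<Rightarrow> nat) \<Rightarrow> nat \<Rightarrow>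
   (nat \<Rightarrow> signal) \<Rightarrow> signal \<Rightarrow> nat \<Rightarrow> signal" where
  "zeta_bar p N a \<kappa> \<kappa>1r y yr i k =
     vec p (\<lambda>l. 1 / (2 + in_degree N a i) *
       (\<Sum>j = 1..N. exp_laplacian N a i j *
          (y j (k - int (\<kappa> i j)) $ l - yr (k - int (exo_delay N a \<kappa> \<kappa>1r i)) $ l)))"

definition zeta_hat ::
  "nat \<Rightarrow> nat \<Rightarrow> (nat \<Rightarrow> nat \<Rightarrow> real) \<Rightarrow> (nat \<Rightarrow> nat \<Rightarrow> nat) \<Rightarrow>
   (nat \<Rightarrow> signal) \<Rightarrow> nat \<Rightarrow> signal" where
  "zeta_hat n N a \<kappa>h \<xi> i k =
     vec n (\<lambda>l. 1 / (2 + in_degree N a i) *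
       (\<Sum>j = 1..N. exp_laplacian N a i j * \<xi> j (k - int (\<kappa>h i j)) $ l))"

lemma sum_dbar:
  assumes "i \<in> {1..N}"
  shows "f i - (\<Sum>j = 1..N. dbar N a i j * f j) =
    1 / (2 + in_degree N a i) * (\<Sum>j = 1..N. exp_laplacian N a i j * f j)"
proof -
  have "(\<Sum>j = 1..N. dbar N a i j * f j) =
      (\<Sum>j = 1..N. (if i = j then f j else 0)
         - 1 / (2 + in_degree N a i) * (exp_laplacian N a i j * f j))"
    by (intro sum.cong) (auto simp: dbar_def algebra_simps divide_inverse)
  then show ?thesis
    using assms by (simp add: sum_subtractf sum_distrib_left)
qed

lemma zeta_bar_dbar:
  assumes "comm_delays N \<kappa>" and "i \<in> {1..N}" and "l < p"
  shows "zeta_bar p N a \<kappa> \<kappa>1r y yr i k $ l =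
    y i k $ l - yr (k - int (exo_delay N a \<kappa> \<kappa>1r i)) $ l -
    (\<Sum>j = 1..N. dbar N a i j *
       (y j (k - int (\<kappa> i j)) $ l - yr (k - int (exo_delay N a \<kappa> \<kappa>1r i)) $ l))"
  using assms sum_dbar[OF assms(2), of
    "\<lambda>j. y j (k - int (\<kappa> i j)) $ l - yr (k - int (exo_delay N a \<kappa> \<kappa>1r i)) $ l" a]
  by (simp add: zeta_bar_def comm_delays_def)

lemma zeta_hat_dbar:
  assumes "comm_delays N \<kappa>h" and "i \<in> {1..N}" and "l < n"
  shows "zeta_hat n N a \<kappa>h \<xi> i k $ l =
    \<xi> i k $ l - (\<Sum>j = 1..N. dbar N a i j * \<xi> j (k - int (\<kappa>h i j)) $ l)"
  using assms sum_dbar[OF assms(2), of "\<lambda>j. \<xi> j (k - int (\<kappa>h i j)) $ l" a]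
  by (simp add: zeta_hat_def comm_delays_def)


section \<open>Delayed regulated state synchronization\<close>

definition delayed_regulated_sync ::
  "nat \<Rightarrow> nat \<Rightarrow> (nat \<Rightarrow> nat \<Rightarrow> real) \<Rightarrow> (nat \<Rightarrow> nat \<Rightarrow> nat) \<Rightarrow> nat \<Rightarrow>
   (nat \<Rightarrow> signal) \<Rightarrow> signal \<Rightarrow> bool" where
  "delayed_regulated_sync n N a \<kappa> \<kappa>1r x xr \<longleftrightarrow>
     (\<forall>i \<in> {1..N}. \<forall>l < n.
        (\<lambda>k::nat. (x i (int k) - xr (int k - int (exo_delay N a \<kappa> \<kappa>1r i))) $ l)
          \<longlonglongrightarrow> 0)"

definition linear_protocol ::
  "nat \<Rightarrow> nat \<Rightarrow> nat \<Rightarrow> real mat \<Rightarrow> real mat \<Rightarrow> real mat \<Rightarrow> real mat \<Rightarrow> real mat \<Rightarrow>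
   nat \<Rightarrow> (nat \<Rightarrow> nat \<Rightarrow> real) \<Rightarrow> (nat \<Rightarrow> nat \<Rightarrow> nat) \<Rightarrow> (nat \<Rightarrow> nat \<Rightarrow> nat) \<Rightarrow> nat \<Rightarrow>
   (nat \<Rightarrow> signal) \<Rightarrow> signal \<Rightarrow> (nat \<Rightarrow> signal) \<Rightarrow> (nat \<Rightarrow> signal) \<Rightarrow> (nat \<Rightarrow> signal) \<Rightarrow> bool" where
  "linear_protocol n p nc Ac Bc1 Bc2 Fc Hc N a \<kappa> \<kappa>h \<kappa>1r y yr xc u \<xi> \<longleftrightarrow>
     (\<forall>i \<in> {1..N}.
        (\<forall>k. xc i k \<in> carrier_vec nc \<and> \<xi> i k \<in> carrier_vec n) \<and>
        (\<forall>k \<ge> 0.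
           xc i (k + 1) = Ac *\<^sub>v xc i k + Bc1 *\<^sub>v zeta_bar p N a \<kappa> \<kappa>1r y yr i k
                            + Bc2 *\<^sub>v zeta_hat n N a \<kappa>h \<xi> i k \<and>
           u i k = Fc *\<^sub>v xc i k \<and>
           \<xi> i k = Hc *\<^sub>v xc i k))"

definition scalable_sync_solvable ::
  "nat \<Rightarrow> nat \<Rightarrow> nat \<Rightarrow> real mat \<Rightarrow> real mat \<Rightarrow> real mat \<Rightarrow> bool" where
  "scalable_sync_solvable n m p A B C \<longleftrightarrow>
     (\<exists>nc. \<exists>Ac \<in> carrier_mat nc nc. \<exists>Bc1 \<in> carrier_mat nc p. \<exists>Bc2 \<in> carrier_mat nc n.
      \<exists>Fc \<in> carrier_mat m nc. \<exists>Hc \<in> carrier_mat n nc.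
      \<forall>N a \<kappa> \<kappa>h \<kappa>1r x u y xr yr xc \<xi>.
        tree_graph N a \<longrightarrow> comm_delays N \<kappa> \<longrightarrow> comm_delays N \<kappa>h \<longrightarrow>
        agent_dynamics n m p A B C N x u y \<longrightarrow>
        exosystem_dynamics n p A C xr yr \<longrightarrow>
        linear_protocol n p nc Ac Bc1 Bc2 Fc Hc N a \<kappa> \<kappa>h \<kappa>1r y yr xc u \<xi> \<longrightarrow>
        delayed_regulated_sync n N a \<kappa> \<kappa>1r x xr)"

definition full_state_protocol ::
  "nat \<Rightarrow> real mat \<Rightarrow> real mat \<Rightarrow> real mat \<Rightarrow>
   nat \<Rightarrow> (nat \<Rightarrow> nat \<Rightarrow> real) \<Rightarrow> (nat \<Rightarrow> nat \<Rightarrow> nat) \<Rightarrow> (nat \<Rightarrow> nat \<Rightarrow> nat) \<Rightarrow> nat \<Rightarrow>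
   (nat \<Rightarrow> signal) \<Rightarrow> signal \<Rightarrow> (nat \<Rightarrow> signal) \<Rightarrow> (nat \<Rightarrow> signal) \<Rightarrow> bool" where
  "full_state_protocol n A B K N a \<kappa> \<kappa>h \<kappa>1r y yr \<chi> u \<longleftrightarrow>
     (\<forall>i \<in> {1..N}.
        (\<forall>k. \<chi> i k \<in> carrier_vec n) \<and>
        (\<forall>k \<ge> 0.
           \<chi> i (k + 1) = A *\<^sub>v \<chi> i k + B *\<^sub>v u i k
                           + A *\<^sub>v zeta_bar n N a \<kappa> \<kappa>1r y yr i k
                           - A *\<^sub>v zeta_hat n N a \<kappa>h \<chi> i k \<and>
           u i k = - (K *\<^sub>v \<chi> i k)))"

end

(* Let xt_i(k) = x_i(k) - x_r(k - kappa_ir) and e_i = xt_i - chi_i. Since kappa_ir = kappa_jr + kappa_ij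
   along every edge from j to i, the delayed exosystem signal cancels in zeta_bar_i, so that
     e_i(k+1) = (1 - c) A e_i(k) + A (h(k) - g(k)),   xt_i(k+1) = (A - B K) xt_i(k) + B K e_i(k),
   with c = lbar_ii / (2 + d_in(i)) in (0,1) and g, h built from the delayed signals xt_j, chi_j of the
   parent j < i. Both (1 - c) A and A - B K are Schur stable, so induction along the tree shows that
   all these signals vanish at infinity: by triangularization over the complex numbers, a Schur stable
   recurrence with vanishing input has vanishing solutions. The delays only shift vanishing signals. *)

theory Submission
  imports Defs "Jordan_Normal_Form.Schur_Decomposition"
begin

section \<open>Decay of stable linear recurrences, from scalars to real matrices\<close>

section \<open>Stable linear recurrences with vanishing inputs\<close>

text \<open>Once the input stays below a constant \<open>c\<close>, the norm of \<open>z\<close> is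
  multiplied by \<open>norm a < 1\<close> and increased by at most \<open>c\<close> in each step.
  Geometric decay leaves a remainder of at most c / (1 - \<open>norm a\<close>), which is as small
  as desired.\<close>

lemma scalar_recurrence_tendsto_0:
  fixes z g :: "int \<Rightarrow> 'a::real_normed_field"
  assumes a: "norm a < 1"
    and rec: "\<forall>\<^sub>F k in at_top. z (k + 1) = a * z k + g k"
    and g: "(g \<longlongrightarrow> 0) at_top"
  shows "(z \<longlongrightarrow> 0) at_top"
proof (rule tendstoI)
  fix d :: real
  assume d: "d > 0"
  define r where "r = norm a"
  have r: "0 \<le> r" "r < 1"
    using a by (auto simp: r_def)
  \<comment> \<open>This makes \<open>d / 2\<close> the fixed point of t -> r * t + c, so the offset
    \<open>d / 2\<close> in the bound below reproduces itself; the other half of \<open>d\<close> is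
    left for the geometric term.\<close>
  define c where "c = d / 2 * (1 - r)"
  have "c > 0"
    using d r by (simp add: c_def)
  then have "\<forall>\<^sub>F k in at_top. norm (g k) < c"
    using tendstoD[OF g] by (simp add: dist_norm)
  with rec have "\<forall>\<^sub>F k in at_top. z (k + 1) = a * z k + g k \<and> norm (g k) < c"
    by eventually_elim simp
  then obtain K where K: "\<And>k. k \<ge> K \<Longrightarrow> z (k + 1) = a * z k + g k \<and> norm (g k) < c"
    by (auto simp: eventually_at_top_linorder)
  have bound: "norm (z (K + int j)) \<le> r ^ j * norm (z K) + d / 2" for j
  proof (induction j)
    case 0
    then show ?case using d by simp
  next
    case (Suc j)
    have "z (K + int (Suc j)) = a * z (K + int j) + g (K + int j)"
      using K[of "K + int j"] by (simp add: algebra_simps)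
    then have "norm (z (K + int (Suc j))) \<le> r * norm (z (K + int j)) + norm (g (K + int j))"
      by (metis norm_triangle_ineq norm_mult r_def)
    also have "\<dots> \<le> r * (r ^ j * norm (z K) + d / 2) + c"
      using Suc K[of "K + int j"] r by (intro add_mono mult_left_mono) auto
    also have "\<dots> = r ^ Suc j * norm (z K) + d / 2"
      by (simp add: c_def field_simps)
    finally show ?case .
  qed
  have "(\<lambda>j. r ^ j * norm (z K)) \<longlonglongrightarrow> 0"
    using r by (intro tendsto_mult_left_zero LIMSEQ_power_zero) auto
  then have "\<forall>\<^sub>F j in sequentially. r ^ j * norm (z K) < d / 2"
    using d by (intro order_tendstoD) auto
  then obtain J where J: "\<And>j. j \<ge> J \<Longrightarrow> r ^ j * norm (z K) < d / 2"
    by (auto simp: eventually_at_top_linorder)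
  have "dist (z k) 0 < d" if "k \<ge> K + int J" for k
    using J[of "nat (k - K)"] bound[of "nat (k - K)"] that by force
  then show "\<forall>\<^sub>F k in at_top. dist (z k) 0 < d"
    by (auto simp: eventually_at_top_linorder)
qed

text \<open>Convergence is componentwise, as in the synchronization goal. The dimension is required
  at all times, negative ones included, so that components can be computed without a side condition
  on \<open>k\<close>. The field stays general because the predicate is used over both the reals and
  the complex numbers.\<close>

definition vanishing :: "nat \<Rightarrow> (int \<Rightarrow> 'a::real_normed_field vec) \<Rightarrow> bool" where
  "vanishing n v \<longleftrightarrow>
     (\<forall>k. v k \<in> carrier_vec n) \<and> (\<forall>l < n. ((\<lambda>k. v k $ l) \<longlongrightarrow> 0) at_top)"

lemma vanishing_carrier: "vanishing n v \<Longrightarrow> v k \<in> carrier_vec n"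
  by (simp add: vanishing_def)

lemma vanishing_diff:
  assumes "vanishing n v" and "vanishing n w"
  shows "vanishing n (\<lambda>k. v k - w k)"
  unfolding vanishing_def
proof (intro conjI allI impI)
  fix l assume l: "l < n"
  have "((\<lambda>k. v k $ l - w k $ l) \<longlongrightarrow> 0 - 0) at_top"
    using assms l by (intro tendsto_diff) (auto simp: vanishing_def)
  moreover have "(v k - w k) $ l = v k $ l - w k $ l" for k
    using l carrier_vecD[OF vanishing_carrier[OF assms(2), of k]] by simp
  ultimately show "((\<lambda>k. (v k - w k) $ l) \<longlongrightarrow> 0) at_top"
    by simp
qed (use assms in \<open>auto simp: vanishing_def\<close>)

lemma mult_mat_vec_index_sum:
  assumes "M \<in> carrier_mat n m" and "v \<in> carrier_vec m" and "i < n"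
  shows "(M *\<^sub>v v) $ i = (\<Sum>j<m. M $$ (i, j) * v $ j)"
  using assms by (auto simp: scalar_prod_def atLeast0LessThan intro!: sum.cong)

lemma vanishing_mult_mat:
  assumes M: "M \<in> carrier_mat n m" and v: "vanishing m v"
  shows "vanishing n (\<lambda>k. M *\<^sub>v v k)"
proof -
  have "((\<lambda>k. (M *\<^sub>v v k) $ l) \<longlongrightarrow> 0) at_top" if "l < n" for l
    using v that
    by (auto simp: mult_mat_vec_index_sum[OF M vanishing_carrier[OF v]] vanishing_def
        intro!: tendsto_null_sum tendsto_mult_right_zero)
  then show ?thesis
    unfolding vanishing_def using mult_mat_vec_carrier[OF M vanishing_carrier[OF v]] by blast
qed

text \<open>Back substitution: row \<open>i\<close> involves only components with index at least
  \<open>i\<close>. Working upwards from the last row, component \<open>i\<close> obeys a scalar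
  recurrence with factor \<open>T $$ (i, i)\<close>, driven by components already known to
  vanish.\<close>

lemma vanishing_upper_triangular_recurrence:
  assumes T: "T \<in> carrier_mat n n" and upper: "upper_triangular T"
    and diag: "\<And>i. i < n \<Longrightarrow> norm (T $$ (i, i)) < 1"
    and w: "\<And>k. w k \<in> carrier_vec n" and g: "vanishing n g"
    and rec: "\<forall>\<^sub>F k in at_top. w (k + 1) = T *\<^sub>v w k + g k"
  shows "vanishing n w"
proof -
  have "((\<lambda>k. w k $ i) \<longlongrightarrow> 0) at_top" if "i < n" for i
    using that
  proof (induction "n - i" arbitrary: i rule: less_induct)
    case less
    \<comment> \<open>Everything in row \<open>i\<close> except the diagonal term counts as input.
      Its terms with \<open>j < i\<close> have coefficient zero, those with \<open>j > i\<close>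
      vanish by induction.\<close>
    define f where "f k = (\<Sum>j\<in>{..<n} - {i}. T $$ (i, j) * w k $ j) + g k $ i" for k
    have "((\<lambda>k. T $$ (i, j) * w k $ j) \<longlongrightarrow> 0) at_top" if "j \<in> {..<n} - {i}" for j
    proof (cases "j < i")
      case True
      then have "T $$ (i, j) = 0"
        using upper T less.prems by (auto simp: upper_triangular_def)
      then show ?thesis by simp
    next
      case False
      then show ?thesis
        using that less by (intro tendsto_mult_right_zero) auto
    qed
    moreover have "((\<lambda>k. g k $ i) \<longlongrightarrow> 0) at_top"
      using g less.prems by (simp add: vanishing_def)
    ultimately have "(f \<longlongrightarrow> 0) at_top"
      unfolding f_def by (intro tendsto_add_zero tendsto_null_sum)
    moreover have "\<forall>\<^sub>F k in at_top. w (k + 1) $ i = T $$ (i, i) * w k $ i + f k"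
      using rec
    proof eventually_elim
      case (elim k)
      have "w (k + 1) $ i = (\<Sum>j<n. T $$ (i, j) * w k $ j) + g k $ i"
        using elim less.prems vanishing_carrier[OF g, of k] T
        by (simp add: mult_mat_vec_index_sum[OF T w] del: index_mult_mat_vec)
      then show ?case
        using less.prems by (simp add: f_def sum.remove[of "{..<n}" i])
    qed
    ultimately show ?case
      by (intro scalar_recurrence_tendsto_0[where z = "\<lambda>k. w k $ i", OF diag[OF less.prems]])
  qed
  then show ?thesis
    using w by (simp add: vanishing_def)
qed

text \<open>Over the complex numbers M = P T Q with T upper triangular and P, Q mutually inverse.
  The coordinates Q v follow the triangular recurrence with input Q f, and v = P (Q v) inherits
  their decay.\<close>

lemma vanishing_complex_recurrence:
  fixes M :: "complex mat"
  assumes M: "M \<in> carrier_mat n n" and stable: "\<And>ev. eigenvalue M ev \<Longrightarrow> cmod ev < 1"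
    and v: "\<And>k. v k \<in> carrier_vec n" and f: "vanishing n f"
    and rec: "\<forall>\<^sub>F k in at_top. v (k + 1) = M *\<^sub>v v k + f k"
  shows "vanishing n v"
proof -
  obtain es where es: "char_poly M = (\<Prod>e\<leftarrow>es. [:- e, 1:])"
    using char_poly_factorized[OF M] by blast
  obtain T P Q where "schur_decomposition M es = (T, P, Q)"
    by (metis prod_cases3)
  from schur_decomposition[OF M es this]
  have wit: "similar_mat_wit M T P Q" and upper: "upper_triangular T"
    and diag: "diag_mat T = es" by auto
  note W = similar_mat_witD2[OF M wit]
  have T_diag: "cmod (T $$ (i, i)) < 1" if "i < n" for i
  proof -
    \<comment> \<open>The diagonal of \<open>T\<close> lists the roots of the characteristic
      polynomial, so each entry is an eigenvalue of \<open>M\<close>.\<close>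
    have "T $$ (i, i) \<in> set es"
      using that W(5) by (auto simp flip: diag simp: diag_mat_def)
    then have "poly (char_poly M) (T $$ (i, i)) = 0"
      by (auto simp: es poly_prod_list prod_list_zero_iff)
    then show ?thesis
      using stable eigenvalue_root_char_poly[OF M] by blast
  qed
  have "vanishing n (\<lambda>k. Q *\<^sub>v v k)"
  proof (rule vanishing_upper_triangular_recurrence[OF W(5) upper T_diag])
    show "vanishing n (\<lambda>k. Q *\<^sub>v f k)"
      by (rule vanishing_mult_mat[OF W(7) f])
    show "\<forall>\<^sub>F k in at_top. Q *\<^sub>v v (k + 1) = T *\<^sub>v (Q *\<^sub>v v k) + Q *\<^sub>v f k"
      using rec
    proof eventually_elim
      case (elim k)
      have "Q * M = Q * P * (T * Q)"
        using W(5-7) by (simp add: W(3) assoc_mult_mat[of _ n n _ n _ n])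
      also have "\<dots> = T * Q"
        using W(2,5,7) by simp
      finally have "Q * M *\<^sub>v v k = T * Q *\<^sub>v v k"
        by simp
      then have "Q *\<^sub>v (M *\<^sub>v v k) = T *\<^sub>v (Q *\<^sub>v v k)"
        by (simp only: assoc_mult_mat_vec[OF W(7) M v] assoc_mult_mat_vec[OF W(5,7) v])
      then show ?case
        using M v vanishing_carrier[OF f, of k]
        by (simp add: elim mult_add_distrib_mat_vec[OF W(7)] del: assoc_mult_mat_vec)
    qed
  qed (use W(7) v in auto)
  from vanishing_mult_mat[OF W(6) this] have "vanishing n (\<lambda>k. P *\<^sub>v (Q *\<^sub>v v k))" .
  moreover have "P *\<^sub>v (Q *\<^sub>v v k) = v k" for k
    by (simp flip: assoc_mult_mat_vec[OF W(6,7) v]) (simp add: W(1) v)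
  ultimately show ?thesis by simp
qed

text \<open>Eigenvalues of a real matrix may be non-real, so the recurrence is embedded into the
  complex numbers; limits are preserved and reflected by \<open>of_real\<close>.\<close>

lemma vanishing_schur_recurrence:
  assumes M: "M \<in> carrier_mat n n" and stable: "schur_stable M"
    and v: "\<And>k. v k \<in> carrier_vec n" and f: "vanishing n f"
    and rec: "\<forall>\<^sub>F k in at_top. v (k + 1) = M *\<^sub>v v k + f k"
  shows "vanishing n v"
proof -
  have [simp]: "dim_vec (v k) = n" "dim_vec (f k) = n" for k
    using v vanishing_carrier[OF f] by auto
  have "vanishing n (\<lambda>k. map_vec complex_of_real (v k))"
  proof (rule vanishing_complex_recurrence)
    show "vanishing n (\<lambda>k. map_vec complex_of_real (f k))"
      unfolding vanishing_def
    proof (intro conjI allI impI)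
      fix l assume l: "l < n"
      then have "((\<lambda>k. complex_of_real (f k $ l)) \<longlongrightarrow> 0) at_top"
        using f tendsto_of_real by (fastforce simp: vanishing_def)
      then show "((\<lambda>k. map_vec complex_of_real (f k) $ l) \<longlongrightarrow> 0) at_top"
        using l by simp
    qed (simp add: carrier_vecI)
    show "\<forall>\<^sub>F k in at_top. map_vec complex_of_real (v (k + 1)) =
        map_mat complex_of_real M *\<^sub>v map_vec complex_of_real (v k)
        + map_vec complex_of_real (f k)"
      using rec
    proof eventually_elim
      case (elim k)
      show ?case
        unfolding elim of_real_hom.mult_mat_vec_hom[OF M v, symmetric]
        using M vanishing_carrier[OF f, of k] by (intro eq_vecI) auto
    qed
  qed (use M v stable in \<open>auto simp: schur_stable_def\<close>)
  then have "((\<lambda>k. complex_of_real (v k $ l)) \<longlongrightarrow> of_real 0) at_top" if "l < n" for l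
    using that by (simp add: vanishing_def)
  then show ?thesis
    using v by (simp only: vanishing_def tendsto_of_real_iff) blast
qed

section \<open>Scaling of matrices with spectrum in the closed unit disc\<close>

lemma smult_mat_mult_vec:
  assumes "A \<in> carrier_mat n m" and "v \<in> carrier_vec m"
  shows "(s \<cdot>\<^sub>m A) *\<^sub>v v = s \<cdot>\<^sub>v (A *\<^sub>v v)"
  using assms
  by (intro eq_vecI) (auto simp: scalar_prod_def sum_distrib_left mult.assoc intro!: sum.cong)

text \<open>An eigenvector of s A for \<open>ev\<close> is one of A for ev / s, whence |ev| is at
  most s. This is how a spectrum that may touch the unit circle still yields stable error
  dynamics.\<close>

lemma schur_stable_smult:
  assumes A: "A \<in> carrier_mat n n" and disc: "eigenvalues_in_closed_disc A" and s: "0 < s" "s < 1"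
  shows "schur_stable (s \<cdot>\<^sub>m A)"
  unfolding schur_stable_def
proof (intro allI impI)
  let ?A = "map_mat complex_of_real A" and ?s = "complex_of_real s"
  fix ev
  assume "eigenvalue (map_mat complex_of_real (s \<cdot>\<^sub>m A)) ev"
  then obtain v where v: "v \<in> carrier_vec (dim_row A)" "v \<noteq> 0\<^sub>v (dim_row A)"
    and eq: "map_mat complex_of_real (s \<cdot>\<^sub>m A) *\<^sub>v v = ev \<cdot>\<^sub>v v"
    by (auto simp: eigenvalue_def eigenvector_def)
  have "?s \<cdot>\<^sub>v (?A *\<^sub>v v) = ev \<cdot>\<^sub>v v"
  proof -
    have "map_mat complex_of_real (s \<cdot>\<^sub>m A) = ?s \<cdot>\<^sub>m ?A"
      by (intro eq_matI) auto
    then have "map_mat complex_of_real (s \<cdot>\<^sub>m A) *\<^sub>v v = ?s \<cdot>\<^sub>v (?A *\<^sub>v v)"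
      using A v by (simp add: smult_mat_mult_vec[of _ n n])
    with eq show ?thesis by simp
  qed
  from arg_cong[OF this, of "\<lambda>w. (1 / ?s) \<cdot>\<^sub>v w"] have "?A *\<^sub>v v = (ev / ?s) \<cdot>\<^sub>v v"
    using s by (simp add: smult_smult_assoc)
  with v have "eigenvalue ?A (ev / ?s)"
    by (auto simp: eigenvalue_def eigenvector_def)
  with disc have "cmod (ev / ?s) \<le> 1"
    by (auto simp: eigenvalues_in_closed_disc_def)
  with s show "cmod ev < 1"
    by (simp add: norm_divide)
qed

section \<open>Node order, parents, root paths and accumulated delays in a tree\<close>

section \<open>Tree graphs and path delays\<close>

text \<open>Lower triangularity of the Laplacian forces node numbers to increase along edges; this
  justifies every induction on node numbers below.\<close>

lemma tree_graph_weight: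
  assumes tree: "tree_graph N a" and "i \<in> {1..N}" "j \<in> {1..N}" "i \<noteq> j" "a i j \<noteq> 0"
  shows "(j, i) \<in> edges N a" and "j < i"
proof -
  have "a i j \<ge> 0"
    using assms by (auto simp: tree_graph_def weighted_graph_def)
  then show "(j, i) \<in> edges N a"
    using assms by (auto simp: edges_def)
  have "i < j \<longrightarrow> laplacian N a i j = 0"
    using assms by (auto simp: tree_graph_def lower_triangular_def)
  then show "j < i"
    using assms by (auto simp: laplacian_def)
qed

lemma tree_graph_edge_less:
  assumes "tree_graph N a" and "(j, i) \<in> edges N a"
  shows "j < i"
proof -
  have "i \<noteq> j"
    using assms by (auto simp: edges_def tree_graph_def weighted_graph_def)
  then show ?thesis
    using assms tree_graph_weight(2)[of N a i j] by (auto simp: edges_def)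
qed

text \<open>The root is only given existentially. Nothing can enter node 1, as the source would have
  a smaller number, while every non-root node has a parent; hence the root is node 1.\<close>

lemma tree_graph_parent:
  assumes tree: "tree_graph N a" and i: "i \<in> {1..N}" "i \<noteq> 1"
  shows "\<exists>!j. (j, i) \<in> edges N a"
proof -
  obtain r where r: "\<And>i. i \<in> {1..N} - {r} \<Longrightarrow> \<exists>!j. (j, i) \<in> edges N a"
    using tree unfolding tree_graph_def directed_spanning_tree_def by blast
  have "(j, 1) \<notin> edges N a" for j
    using tree_graph_edge_less[OF tree, of j 1] by (auto simp: edges_def)
  then have "r = 1"
    using r[of 1] i by fastforce
  with r i show ?thesis by simp
qed

text \<open>The parent of \<open>i\<close> is unique, so the last edge of any root path to
  \<open>i\<close> must start in \<open>j\<close>. Existence, uniqueness and delay of the path to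
  \<open>i\<close> thereby reduce to those of the path to \<open>j\<close>.\<close>

lemma root_path_edge:
  assumes tree: "tree_graph N a" and e: "(j, i) \<in> edges N a"
  shows "root_path N a i p \<longleftrightarrow> (\<exists>q. p = q @ [i] \<and> root_path N a j q)"
proof
  assume p: "root_path N a i p"
  then obtain q where q: "p = q @ [i]"
    by (metis append_butlast_last_id root_path_def)
  have "i \<noteq> 1"
    using tree_graph_edge_less[OF tree e] e by (auto simp: edges_def)
  \<comment> \<open>Otherwise \<open>p\<close> would be \<open>[i]\<close>, whose head is not
    1.\<close>
  with p q have "q \<noteq> []"
    by (auto simp: root_path_def)
  have step: "(p ! l, p ! Suc l) \<in> edges N a" if "Suc l < length p" for l
    using p that by (simp add: root_path_def)
  have "(last q, i) \<in> edges N a"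
    using step[of "length q - 1"] q \<open>q \<noteq> []\<close> by (simp add: nth_append last_conv_nth)
  then have "last q = j"
    using tree_graph_parent[OF tree] e \<open>i \<noteq> 1\<close> by (auto simp: edges_def)
  moreover have "(q ! l, q ! Suc l) \<in> edges N a" if "Suc l < length q" for l
    using step[of l] q that by (simp add: nth_append)
  ultimately have "root_path N a j q"
    using p q \<open>q \<noteq> []\<close> by (simp add: root_path_def)
  with q show "\<exists>q. p = q @ [i] \<and> root_path N a j q" by blast
next
  assume "\<exists>q. p = q @ [i] \<and> root_path N a j q"
  then obtain q where q: "p = q @ [i]" "root_path N a j q" by blast
  have "(p ! l, p ! Suc l) \<in> edges N a" if "Suc l < length p" for l
  proof (cases "Suc l < length q")
    case True
    with q show ?thesis by (auto simp: root_path_def nth_append)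
  next
    case False
    then have "Suc l = length q"
      using that q by simp
    then have "p ! l = last q" "p ! Suc l = i"
      using q by (auto simp: nth_append last_conv_nth root_path_def simp flip: \<open>Suc l = length q\<close>)
    with q e show ?thesis by (simp add: root_path_def)
  qed
  with q e show "root_path N a i p"
    by (auto simp: root_path_def edges_def)
qed

text \<open>This makes the \<open>THE\<close> in \<open>exo_delay\<close> meaningful. Induction on
  the node number, passing from a node to its parent.\<close>

lemma root_path_unique:
  assumes tree: "tree_graph N a" and "i \<in> {1..N}"
  shows "\<exists>!p. root_path N a i p"
  using assms(2)
proof (induction i rule: less_induct)
  case (less i)
  show ?case
  proof (cases "i = 1")
    case True
    have "root_path N a 1 [1]"
      using less.prems by (auto simp: root_path_def)
    moreover have "p = [1]" if "root_path N a 1 p" for p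
    proof (rule ccontr)
      assume "p \<noteq> [1]"
      have p: "p \<noteq> []" "last p = 1" "hd p = 1"
        using that by (auto simp: root_path_def)
      with \<open>p \<noteq> [1]\<close> have "length p \<noteq> 1"
        by (auto simp: length_Suc_conv)
      \<comment> \<open>A path other than \<open>[1]\<close> has at least two nodes, so its final
        edge, at index \<open>length p - 2\<close>, would enter node 1.\<close>
      with p have len: "Suc (length p - 2) = length p - 1" "Suc (length p - 2) < length p"
        by (cases p; simp)+
      have "(p ! (length p - 2), p ! Suc (length p - 2)) \<in> edges N a"
        using that len(2) by (simp add: root_path_def)
      then have "(p ! (length p - 2), 1) \<in> edges N a"
        using p by (simp add: len(1) last_conv_nth)
      from tree_graph_edge_less[OF tree this] this show False
        by (auto simp: edges_def)
    qed
    ultimately show ?thesis using True by blast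
  next
    case False
    then obtain j where j: "(j, i) \<in> edges N a"
      using tree_graph_parent[OF tree less.prems] by blast
    have "\<exists>!q. root_path N a j q"
      using less.IH[of j] tree_graph_edge_less[OF tree j] j by (auto simp: edges_def)
    then show ?thesis
      unfolding root_path_edge[OF tree j] by blast
  qed
qed

text \<open>The path to \<open>i\<close> is the path to \<open>j\<close> extended by
  \<open>i\<close>, so the delay sum gains just the term of the new edge.\<close>

lemma exo_delay_edge:
  assumes tree: "tree_graph N a" and e: "(j, i) \<in> edges N a"
  shows "exo_delay N a \<kappa> \<kappa>1r i = exo_delay N a \<kappa> \<kappa>1r j + \<kappa> i j"
proof -
  have "j \<in> {1..N}" "i \<in> {1..N}"
    using e by (auto simp: edges_def)
  then obtain q where q: "root_path N a j q" "(THE p. root_path N a j p) = q"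
    using root_path_unique[OF tree] by (metis theI')
  have "root_path N a i (q @ [i])"
    using q root_path_edge[OF tree e] by blast
  then have p: "(THE p. root_path N a i p) = q @ [i]"
    using root_path_unique[OF tree \<open>i \<in> {1..N}\<close>] by (simp add: the1_equality)
  \<comment> \<open>Resolves the truncated subtraction: the sum for \<open>q @ [i]\<close> runs over
    \<open>l < Suc m\<close>, and its top term \<open>l = m\<close> is the delay
    \<open>\<kappa> i j\<close>.\<close>
  obtain m where m: "length q = Suc m"
    using q by (cases q) (auto simp: root_path_def)
  have "q ! m = j"
    using q m by (auto simp: root_path_def last_conv_nth)
  then show ?thesis
    unfolding exo_delay_def q p Let_def using m by (simp add: nth_append)
qed

section \<open>One-step error dynamics of an agent and induction over the tree\<close>

section \<open>Synchronization\<close>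

text \<open>Here X is the shifted state error, Y the protocol state and w the common input B u,
  which cancels. The diagonal terms c X and c Y of the exchanged data combine into -c A (X - Y); g
  and h carry the neighbours' contributions.\<close>

lemma estimation_error_step:
  fixes A :: "real mat"
  assumes A: "A \<in> carrier_mat n n" and c: "X \<in> carrier_vec n" "Y \<in> carrier_vec n"
    "g \<in> carrier_vec n" "h \<in> carrier_vec n" "w \<in> carrier_vec n"
  shows "(A *\<^sub>v X + w) - (A *\<^sub>v Y + w + A *\<^sub>v (c \<cdot>\<^sub>v X + g) - A *\<^sub>v (c \<cdot>\<^sub>v Y + h)) =
    ((1 - c) \<cdot>\<^sub>m A) *\<^sub>v (X - Y) + (A *\<^sub>v h - A *\<^sub>v g)"
proof -
  define X' Y' g' h' where "X' = A *\<^sub>v X" "Y' = A *\<^sub>v Y" "g' = A *\<^sub>v g" "h' = A *\<^sub>v h"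
  then have "X' \<in> carrier_vec n" "Y' \<in> carrier_vec n" "g' \<in> carrier_vec n" "h' \<in> carrier_vec n"
    using A c by auto
  moreover have "A *\<^sub>v (c \<cdot>\<^sub>v X + g) = c \<cdot>\<^sub>v X' + g'" "A *\<^sub>v (c \<cdot>\<^sub>v Y + h) = c \<cdot>\<^sub>v Y' + h'"
    "((1 - c) \<cdot>\<^sub>m A) *\<^sub>v (X - Y) = (1 - c) \<cdot>\<^sub>v (X' - Y')"
    using A c
    by (simp_all add: X'_Y'_g'_h'_def mult_add_distrib_mat_vec[OF A] mult_minus_distrib_mat_vec[OF A]
        mult_mat_vec[OF A] smult_mat_mult_vec[OF A])
  ultimately show ?thesis
    unfolding X'_Y'_g'_h'_def(1,2,3,4)[symmetric] using c
    by (auto intro!: eq_vecI simp: algebra_simps)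
qed

lemma mult_mat_uminus_vec:
  fixes B :: "'a::comm_ring_1 mat"
  assumes "B \<in> carrier_mat n m" and "v \<in> carrier_vec m"
  shows "B *\<^sub>v (- v) = - (B *\<^sub>v v)"
  using assms by (auto intro!: eq_vecI)

text \<open>Writing Y = X - (X - Y) turns feedback from the protocol state into ideal feedback from
  X, disturbed by the estimation error.\<close>

lemma feedback_split:
  fixes A B K :: "real mat"
  assumes A: "A \<in> carrier_mat n n" and B: "B \<in> carrier_mat n m" and K: "K \<in> carrier_mat m n"
    and c: "X \<in> carrier_vec n" "Y \<in> carrier_vec n"
  shows "A *\<^sub>v X + B *\<^sub>v (- (K *\<^sub>v Y)) = (A - B * K) *\<^sub>v X + B * K *\<^sub>v (X - Y)"
proof -
  have BK: "B * K \<in> carrier_mat n n"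
    using B K by simp
  have "B *\<^sub>v (- (K *\<^sub>v Y)) = - (B * K *\<^sub>v Y)"
    using B K c by (simp add: mult_mat_uminus_vec[of _ n m])
  then show ?thesis
    using A BK c
    by (auto intro!: eq_vecI simp: minus_mult_distrib_mat_vec[OF A BK]
        mult_minus_distrib_mat_vec[OF BK] simp del: assoc_mult_mat_vec)
qed

lemma full_state_protocol_sync:
  fixes A B K :: "real mat"
  assumes A: "A \<in> carrier_mat n n" and B: "B \<in> carrier_mat n m" and K: "K \<in> carrier_mat m n"
    and disc: "eigenvalues_in_closed_disc A" and stable: "schur_stable (A - B * K)"
    and tree: "tree_graph N a" and \<kappa>: "comm_delays N \<kappa>" and \<kappa>h: "comm_delays N \<kappa>h"
    and agents: "agent_dynamics n m n A B (1\<^sub>m n) N x u y"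
    and exo: "exosystem_dynamics n n A (1\<^sub>m n) xr yr"
    and protocol: "full_state_protocol n A B K N a \<kappa> \<kappa>h \<kappa>1r y yr \<chi> u"
  shows "delayed_regulated_sync n N a \<kappa> \<kappa>1r x xr"
proof -
  define d where "d = exo_delay N a \<kappa> \<kappa>1r"
  define xt where "xt i k = x i k - xr (k - int (d i))" for i k
  have xr: "xr k \<in> carrier_vec n" for k
    using exo by (simp add: exosystem_dynamics_def)
  have xr_step: "xr (k + 1) = A *\<^sub>v xr k" and yr: "yr k = xr k" if "k \<ge> 0" for k
    using exo that xr[of k] by (auto simp: exosystem_dynamics_def)
  have x: "x i k \<in> carrier_vec n" and u: "u i k \<in> carrier_vec m" and \<chi>: "\<chi> i k \<in> carrier_vec n"
    if "i \<in> {1..N}" for i k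
    using agents protocol that by (auto simp: agent_dynamics_def full_state_protocol_def)
  have x_step: "x i (k + 1) = A *\<^sub>v x i k + B *\<^sub>v u i k" and y: "y i k = x i k"
    if "i \<in> {1..N}" "k \<ge> 0" for i k
    using agents that x[of i k] by (auto simp: agent_dynamics_def)
  have \<chi>_step: "\<chi> i (k + 1) = A *\<^sub>v \<chi> i k + B *\<^sub>v u i k
      + A *\<^sub>v zeta_bar n N a \<kappa> \<kappa>1r y yr i k - A *\<^sub>v zeta_hat n N a \<kappa>h \<chi> i k"
    and u_eq: "u i k = - (K *\<^sub>v \<chi> i k)" if "i \<in> {1..N}" "k \<ge> 0" for i k
    using protocol that by (auto simp: full_state_protocol_def)
  have xt: "xt i k \<in> carrier_vec n" if "i \<in> {1..N}" for i k
    using x xr that by (simp add: xt_def)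
  \<comment> \<open>The exosystem equation is available only from time 0 on, so
    \<open>k - int (d i)\<close> must be nonnegative. For this reason the recurrences are only
    required eventually.\<close>
  have xt_step: "xt i (k + 1) = A *\<^sub>v xt i k + B *\<^sub>v u i k" if "i \<in> {1..N}" "k \<ge> int (d i)" for i k
  proof -
    have "xt i (k + 1) = A *\<^sub>v x i k + B *\<^sub>v u i k - A *\<^sub>v xr (k - int (d i))"
      using x_step[of i k] xr_step[of "k - int (d i)"] that by (simp add: xt_def algebra_simps)
    also have "A *\<^sub>v xt i k = A *\<^sub>v x i k - A *\<^sub>v xr (k - int (d i))"
      unfolding xt_def using that by (intro mult_minus_distrib_mat_vec[OF A] x xr)
    ultimately show ?thesis
      using A B x[of i k] u[of i k] xr that by (auto intro!: eq_vecI)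
  qed
  have ev_ge: "\<forall>\<^sub>F k in at_top. int (d i) \<le> k" for i
    by (rule eventually_ge_at_top)
  have shift: "filterlim (\<lambda>k::int. k - c) at_top at_top" for c
    unfolding filterlim_at_top eventually_at_top_linorder
    by (metis diff_right_mono add_diff_cancel_right')
  \<comment> \<open>Both signals are carried through the induction: a parent's state error enters
    \<open>g\<close>, its protocol state enters \<open>h\<close>.\<close>
  have main: "vanishing n (xt i) \<and> vanishing n (\<chi> i)" if "i \<in> {1..N}" for i
    using that
  proof (induction i rule: less_induct)
    case (less i)
    note i = less.prems
    define D where "D = in_degree N a i"
    define c where "c = exp_laplacian N a i i / (2 + D)"
    define g where "g k = vec n (\<lambda>l. 1 / (2 + D) * (\<Sum>j\<in>{1..N} - {i}. exp_laplacian N a i j *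
      (y j (k - int (\<kappa> i j)) $ l - yr (k - int (d i)) $ l)))" for k
    define h where "h k = vec n (\<lambda>l. 1 / (2 + D) * (\<Sum>j\<in>{1..N} - {i}. exp_laplacian N a i j *
      \<chi> j (k - int (\<kappa>h i j)) $ l))" for k
    have nonneg: "a i j \<ge> 0" if "j \<in> {1..N}" for j
      using tree i that by (auto simp: tree_graph_def weighted_graph_def)
    then have "D \<ge> 0"
      by (auto simp: D_def in_degree_def intro!: sum_nonneg)
    \<comment> \<open>The numerator of \<open>c\<close> is \<open>D + iota i\<close>. At the root
      \<open>iota\<close> makes it positive; at any other node the incoming edge has to.\<close>
    have "D > 0" if i1: "i \<noteq> 1"
    proof -
      obtain j where "(j, i) \<in> edges N a"
        using tree_graph_parent[OF tree i i1] by blast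
      then show ?thesis
        using nonneg by (auto simp: D_def in_degree_def edges_def intro!: sum_pos2[of _ j])
    qed
    with \<open>D \<ge> 0\<close> have c: "0 < c" "c < 1"
      by (auto simp: c_def exp_laplacian_def laplacian_def iota_def D_def in_degree_def
          divide_simps)
    have off_diag: "exp_laplacian N a i j = 0 \<or> (j, i) \<in> edges N a \<and> j < i"
      if "j \<in> {1..N} - {i}" for j
      using tree_graph_weight[OF tree i, of j] that
      by (auto simp: exp_laplacian_def laplacian_def)
    have g: "vanishing n g"
    proof -
      have summand: "((\<lambda>k. exp_laplacian N a i j * (y j (k - int (\<kappa> i j)) $ l - yr (k - int (d i)) $ l))
          \<longlongrightarrow> 0) at_top" if "j \<in> {1..N} - {i}" "l < n" for j l
        using off_diag[OF that(1)]
      proof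
        assume e: "(j, i) \<in> edges N a \<and> j < i"
        then have di: "d i = d j + \<kappa> i j"
          using exo_delay_edge[OF tree] by (simp add: d_def)
        have "((\<lambda>k. xt j k $ l) \<longlongrightarrow> 0) at_top"
          using less.IH[of j] e that by (auto simp: vanishing_def)
        from filterlim_compose[OF this shift[of "int (\<kappa> i j)"]]
        have "((\<lambda>k. xt j (k - int (\<kappa> i j)) $ l) \<longlongrightarrow> 0) at_top" .
        \<comment> \<open>Since d_i = d_j + \<kappa>_ij, the exosystem is sampled at the same time
          \<open>k - int (d i)\<close> on both sides. Eventually all sampled times are nonnegative,
          where outputs equal states.\<close>
        moreover have "\<forall>\<^sub>F k in at_top. xt j (k - int (\<kappa> i j)) $ l =
            y j (k - int (\<kappa> i j)) $ l - yr (k - int (d i)) $ l"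
          using ev_ge[of i]
        proof eventually_elim
          case (elim k)
          then show ?case
            using that di y[of j "k - int (\<kappa> i j)"] yr[of "k - int (d i)"]
              carrier_vecD[OF xr[of "k - int (d i)"]]
            by (simp add: xt_def algebra_simps)
        qed
        ultimately show ?thesis
          by (intro tendsto_mult_right_zero) (rule Lim_transform_eventually)
      qed simp
      show ?thesis
        unfolding vanishing_def
      proof (intro conjI allI impI)
        fix l assume l: "l < n"
        show "((\<lambda>k. g k $ l) \<longlongrightarrow> 0) at_top"
          unfolding g_def index_vec[OF l]
          by (intro tendsto_mult_right_zero tendsto_null_sum summand l)
      qed (simp add: g_def)
    qed
    have h: "vanishing n h"
    proof -
      have summand: "((\<lambda>k. exp_laplacian N a i j * \<chi> j (k - int (\<kappa>h i j)) $ l) \<longlongrightarrow> 0) at_top"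
        if "j \<in> {1..N} - {i}" "l < n" for j l
        using off_diag[OF that(1)]
      proof
        assume "(j, i) \<in> edges N a \<and> j < i"
        then have "((\<lambda>k. \<chi> j k $ l) \<longlongrightarrow> 0) at_top"
          using less.IH[of j] that by (auto simp: vanishing_def)
        from filterlim_compose[OF this shift[of "int (\<kappa>h i j)"]] show ?thesis
          by (rule tendsto_mult_right_zero)
      qed simp
      show ?thesis
        unfolding vanishing_def
      proof (intro conjI allI impI)
        fix l assume l: "l < n"
        show "((\<lambda>k. h k $ l) \<longlongrightarrow> 0) at_top"
          unfolding h_def index_vec[OF l]
          by (intro tendsto_mult_right_zero tendsto_null_sum summand l)
      qed (simp add: h_def)
    qed
    have bar: "zeta_bar n N a \<kappa> \<kappa>1r y yr i k = c \<cdot>\<^sub>v xt i k + g k" if "k \<ge> int (d i)" for k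
    proof (intro eq_vecI)
      fix l assume "l < dim_vec (c \<cdot>\<^sub>v xt i k + g k)"
      then have l: "l < n" by (simp add: g_def)
      have "y i k $ l - yr (k - int (d i)) $ l = xt i k $ l" "\<kappa> i i = 0"
        using y[OF i, of k] yr[of "k - int (d i)"] that l \<kappa> i carrier_vecD[OF xr[of "k - int (d i)"]]
        by (auto simp: xt_def comm_delays_def)
      then show "zeta_bar n N a \<kappa> \<kappa>1r y yr i k $ l = (c \<cdot>\<^sub>v xt i k + g k) $ l"
        using i l carrier_vecD[OF xt[OF i, of k]]
        by (simp add: zeta_bar_def g_def c_def sum.remove[of "{1..N}" i] distrib_left
            flip: d_def D_def del: One_nat_def)
    qed (simp add: zeta_bar_def g_def)
    \<comment> \<open>Valid at all times, because \<open>\<chi>\<close> itself is exchanged and no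
      output equation is involved.\<close>
    have hat: "zeta_hat n N a \<kappa>h \<chi> i k = c \<cdot>\<^sub>v \<chi> i k + h k" for k
    proof (intro eq_vecI)
      fix l assume "l < dim_vec (c \<cdot>\<^sub>v \<chi> i k + h k)"
      then have l: "l < n" by (simp add: h_def)
      have "\<kappa>h i i = 0"
        using \<kappa>h i by (auto simp: comm_delays_def)
      then show "zeta_hat n N a \<kappa>h \<chi> i k $ l = (c \<cdot>\<^sub>v \<chi> i k + h k) $ l"
        using i l carrier_vecD[OF \<chi>[OF i, of k]]
        by (simp add: zeta_hat_def h_def c_def sum.remove[of "{1..N}" i] distrib_left
            flip: D_def del: One_nat_def)
    qed (simp add: zeta_hat_def h_def)
    have err: "vanishing n (\<lambda>k. xt i k - \<chi> i k)"
    proof (rule vanishing_schur_recurrence)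
      show "schur_stable ((1 - c) \<cdot>\<^sub>m A)"
        using c by (intro schur_stable_smult[OF A disc]) auto
      show "vanishing n (\<lambda>k. A *\<^sub>v h k - A *\<^sub>v g k)"
        by (intro vanishing_diff vanishing_mult_mat[OF A] g h)
      show "\<forall>\<^sub>F k in at_top. xt i (k + 1) - \<chi> i (k + 1) =
          ((1 - c) \<cdot>\<^sub>m A) *\<^sub>v (xt i k - \<chi> i k) + (A *\<^sub>v h k - A *\<^sub>v g k)"
        using ev_ge[of i]
      proof eventually_elim
        case (elim k)
        then have "k \<ge> 0" by simp
        show ?case
          unfolding xt_step[OF i elim] \<chi>_step[OF i \<open>k \<ge> 0\<close>] bar[OF elim] hat
          by (intro estimation_error_step[OF A] xt[OF i] \<chi>[OF i] vanishing_carrier[OF g]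
              vanishing_carrier[OF h] mult_mat_vec_carrier[OF B u[OF i]])
      qed
    qed (use A xt[OF i] \<chi>[OF i] in auto)
    have "vanishing n (xt i)"
    proof (rule vanishing_schur_recurrence[OF _ stable xt[OF i]])
      show "vanishing n (\<lambda>k. B * K *\<^sub>v (xt i k - \<chi> i k))"
        using B K by (intro vanishing_mult_mat[OF _ err]) auto
      show "\<forall>\<^sub>F k in at_top. xt i (k + 1) =
          (A - B * K) *\<^sub>v xt i k + B * K *\<^sub>v (xt i k - \<chi> i k)"
        using ev_ge[of i]
      proof eventually_elim
        case (elim k)
        then have "k \<ge> 0" by simp
        show ?case
          unfolding xt_step[OF i elim] u_eq[OF i \<open>k \<ge> 0\<close>]
          by (rule feedback_split[OF A B K xt[OF i] \<chi>[OF i]])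
      qed
    qed (use A B K in auto)
    moreover have "xt i k - (xt i k - \<chi> i k) = \<chi> i k" for k
      using xt[OF i, of k] \<chi>[OF i, of k] by (auto intro!: eq_vecI)
    ultimately show ?case
      using vanishing_diff[OF _ err, of "xt i"] by simp
  qed
  \<comment> \<open>Passage from integer time to the natural-number sequence of the goal.\<close>
  have "(\<lambda>k. xt i (int k) $ l) \<longlonglongrightarrow> 0" if "i \<in> {1..N}" "l < n" for i l
    using main[OF that(1)] that(2) filterlim_int_sequentially
    by (auto simp: vanishing_def intro: filterlim_compose)
  then show ?thesis
    by (simp add: delayed_regulated_sync_def xt_def d_def)
qed

text \<open>Inserting u = -K \<chi> into the observer equation gives the state matrix A - B K, input
  matrices A and -A, and output matrices -K and the identity; none of them involves the graph or the
  delays.\<close>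

lemma scalable_sync_solvable_full_state:
  fixes A B K :: "real mat"
  assumes A: "A \<in> carrier_mat n n" and B: "B \<in> carrier_mat n m" and K: "K \<in> carrier_mat m n"
    and disc: "eigenvalues_in_closed_disc A" and stable: "schur_stable (A - B * K)"
  shows "scalable_sync_solvable n m n A B (1\<^sub>m n)"
  unfolding scalable_sync_solvable_def
proof (intro exI bexI allI impI)
  fix N a \<kappa> \<kappa>h \<kappa>1r x u y xr yr xc \<xi>
  assume tree: "tree_graph N a" and \<kappa>: "comm_delays N \<kappa>" and \<kappa>h: "comm_delays N \<kappa>h"
    and agents: "agent_dynamics n m n A B (1\<^sub>m n) N x u y"
    and exo: "exosystem_dynamics n n A (1\<^sub>m n) xr yr"
    and lin: "linear_protocol n n n (A - B * K) A (- A) (- K) (1\<^sub>m n) N a \<kappa> \<kappa>h \<kappa>1r y yr xc u \<xi>"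
  \<comment> \<open>At negative times the transmitted variable is initial data unrelated to the protocol state.\<close>
  define \<chi> where "\<chi> i k = (if k < 0 then \<xi> i k else xc i k)" for i k
  have "full_state_protocol n A B K N a \<kappa> \<kappa>h \<kappa>1r y yr \<chi> u"
    unfolding full_state_protocol_def
  proof (intro ballI conjI allI impI)
    fix i and k :: int
    assume i: "i \<in> {1..N}"
    have xc: "xc i k \<in> carrier_vec n" for k
      using lin i by (auto simp: linear_protocol_def)
    then show \<chi>k: "\<chi> i k \<in> carrier_vec n"
      using lin i by (auto simp: linear_protocol_def \<chi>_def)
    assume k: "0 \<le> k"
    have \<xi>: "\<xi> j k = \<chi> j k" if "j \<in> {1..N}" for j k
      using lin that by (auto simp: linear_protocol_def \<chi>_def)
    then have hat: "zeta_hat n N a \<kappa>h \<xi> i k = zeta_hat n N a \<kappa>h \<chi> i k"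
      by (auto simp: zeta_hat_def intro!: eq_vecI sum.cong)
    show u: "u i k = - (K *\<^sub>v \<chi> i k)"
      using lin i k xc[of k] K by (auto simp: linear_protocol_def \<chi>_def)
    let ?b = "zeta_bar n N a \<kappa> \<kappa>1r y yr i k" and ?h = "zeta_hat n N a \<kappa>h \<chi> i k"
    have c: "?b \<in> carrier_vec n" "?h \<in> carrier_vec n"
      by (auto simp: zeta_bar_def zeta_hat_def)
    \<comment> \<open>Both \<open>k\<close> and \<open>k + 1\<close> are nonnegative, so
      \<open>\<chi>\<close> agrees with \<open>xc\<close> at both times.\<close>
    have "\<chi> i (k + 1) = (A - B * K) *\<^sub>v \<chi> i k + A *\<^sub>v ?b + - A *\<^sub>v ?h"
      using lin i k hat by (auto simp: linear_protocol_def \<chi>_def)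
    also have "(A - B * K) *\<^sub>v \<chi> i k = A *\<^sub>v \<chi> i k + B *\<^sub>v u i k"
      using A B K \<chi>k by (auto intro!: eq_vecI
          simp: u mult_mat_uminus_vec[of _ n m] minus_mult_distrib_mat_vec[of _ n n])
    also have "- A *\<^sub>v ?h = - (A *\<^sub>v ?h)"
      using A c by simp
    finally show "\<chi> i (k + 1) = A *\<^sub>v \<chi> i k + B *\<^sub>v u i k + A *\<^sub>v ?b - A *\<^sub>v ?h"
      using A B c by (auto intro!: eq_vecI)
  qed
  from full_state_protocol_sync[OF A B K disc stable tree \<kappa> \<kappa>h agents exo this]
  show "delayed_regulated_sync n N a \<kappa> \<kappa>1r x xr" .
qed (use A B K in auto)

theorem theorem1:
  fixes n m :: nat and A B C :: "real mat"
  assumes A: "A \<in> carrier_mat n n"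
    and B: "B \<in> carrier_mat n m"
    and C: "C = 1\<^sub>m n"
    and disc: "eigenvalues_in_closed_disc A"
    and stab: "stabilizable A B"
    and det: "detectable A C"
  shows "scalable_sync_solvable n m n A B C \<and>
    (\<forall>K \<in> carrier_mat m n. schur_stable (A - B * K) \<longrightarrow>
      (\<forall>N a \<kappa> \<kappa>h \<kappa>1r x u y xr yr \<chi>.
        tree_graph N a \<longrightarrow> comm_delays N \<kappa> \<longrightarrow> comm_delays N \<kappa>h \<longrightarrow>
        agent_dynamics n m n A B C N x u y \<longrightarrow>
        exosystem_dynamics n n A C xr yr \<longrightarrow>
        full_state_protocol n A B K N a \<kappa> \<kappa>h \<kappa>1r y yr \<chi> u \<longrightarrow>
        delayed_regulated_sync n N a \<kappa> \<kappa>1r x xr))"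
proof (intro conjI ballI allI impI)
  obtain K where "K \<in> carrier_mat m n" "schur_stable (A - B * K)"
    using stab A B by (auto simp: stabilizable_def)
  then show "scalable_sync_solvable n m n A B C"
    unfolding C by (rule scalable_sync_solvable_full_state[OF A B _ disc])
next
  fix K N a \<kappa> \<kappa>h \<kappa>1r x u y xr yr \<chi>
  assume "K \<in> carrier_mat m n" "schur_stable (A - B * K)" "tree_graph N a"
    "comm_delays N \<kappa>" "comm_delays N \<kappa>h" "agent_dynamics n m n A B C N x u y"
    "exosystem_dynamics n n A C xr yr" "full_state_protocol n A B K N a \<kappa> \<kappa>h \<kappa>1r y yr \<chi> u"
  then show "delayed_regulated_sync n N a \<kappa> \<kappa>1r x xr"
    unfolding C by (rule full_state_protocol_sync[OF A B _ disc])
qed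

end
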